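(* If $K$ is a welded knot, then $$\frac{1}{2}\, u_w(K)\ \leq\ ut(K)\ \leq\ d(K),$$ where $u_w(K)$ is the welded unknotting number, $ut(K)$ the unknotting twist number and $d(K)$ the warping degree of $K$.
   Context: A welded knot diagram is a generic immersion of one circle in the plane in which every double point is marked either as a classical crossing (with over/under information) or as a welded crossing (no over/under information). Welded Reidemeister moves are: the classical Reidemeister moves RI, RII, RIII; the moves VRI, VRII, VRIII (the versions of RI, RII, RIII in which all crossings are welded); the move SV (the Reidemeister-III-type move in which an arc having two welded crossings is moved across a classical crossing); and the move $F_1$ (the Reidemeister-III-type move in which an arc passing over two strands at two classical crossings is moved across the welded crossing of these two strands). Two diagrams are equivalent if related by a finite sequence of welded Reidemeister moves (and planar isotopy); a welded knot $K$ is an equivalence class, and $D\in[K]$ means that $D$ is a diagram of $K$. The trivial welded knot is the class of the diagram without crossings. Equivalently, a diagram up to VRI, VRII, VRIII, SV is determined by its signed Gauss diagram (one arrow per classical crossing, from over- to under-passage, labelled by the sign of the crossing); $F_1$ exchanges two adjacent arrow tails. Twist move at a classical crossing $c$: replace a small neighbourhood of $c$, viewed as a 2-strand tangle consisting of the single crossing $c$, by the 2-strand tangle obtained by placing a welded crossing of the two strands on each of two opposite sides of the classical crossing (a vertical stack welded–classical–welded), the classical crossing being drawn with the same picture; the inverse replacement is also a twist move. It exchanges the over- and under-passing strands at $c$ while preserving the sign of $c$ (on the Gauss diagram: reverses the arrow of $c$, keeps its sign). Unknotting twist number: $ut(D)$ is the minimum number of twist moves (applied at classical crossings of $D$) required to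 change $D$ into a diagram of the trivial welded knot, and $ut(K)=\min\{ut(D)\mid D\in[K]\}$. Welded unknotting number: $u_w(D)$ is the minimum number of classical crossings of $D$ that must be changed to welded crossings so that the resulting diagram is a diagram of the trivial welded knot, and $u_w(K)=\min\{u_w(D)\mid D\in[K]\}$. Warping degree: for an oriented diagram $D$ and a non-crossing base point $a$ on $D$, $d(D_a)$ is the number of classical crossings that are met first at the under-crossing point when traversing $D$ once from $a$ along the orientation; $d(D)=\min_a d(D_a)$; $-D$ is $D$ with reversed orientation; and $d(K)=\min\{d(D), d(-D)\mid D\in[K]\}$. *)

theory Defs
  imports Complex_Main
begin

text \<open>
  A welded knot diagram, taken up to planar isotopy and the moves VRI, VRII, VRIII and SV, is the
  same thing as a signed Gauss diagram: an oriented circle with one signed arrow per classical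
  crossing, pointing from the over-passage to the under-passage. A Gauss diagram is represented
  here by the word of passages read along the circle from a base point. The welded crossings leave
  no trace in the word. Base point and crossing labels are arbitrary choices, and are accounted for
  by the steps rotate and relabel below.
\<close>

datatype sign = Pos | Neg

fun opp :: "sign \<Rightarrow> sign" where
  "opp Pos = Neg"
| "opp Neg = Pos"

datatype passage = Over (label: nat) (sgn_of: sign) | Under (label: nat) (sgn_of: sign)

type_synonym code = "passage list"

definition crossings :: "code \<Rightarrow> nat set" where
  "crossings w = label ` set w"

text \<open>Each label that occurs, occurs once as Over and once as Under, with the same sign.\<close>

definition gauss_code :: "code \<Rightarrow> bool" where
  "gauss_code w \<longleftrightarrow> distinct w \<and>
     (\<forall>c\<in>crossings w. \<exists>e. {x \<in> set w. label x = c} = {Over c e, Under c e})"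

primrec relabel :: "(nat \<Rightarrow> nat) \<Rightarrow> passage \<Rightarrow> passage" where
  "relabel f (Over c e) = Over (f c) e"
| "relabel f (Under c e) = Under (f c) e"

definition pair_in_order :: "bool \<Rightarrow> passage \<Rightarrow> passage \<Rightarrow> code" where
  "pair_in_order p x y = (if p then [x, y] else [y, x])"

text \<open>
  In the third Reidemeister move the top strand passes over the middle strand at \<open>a\<close> and over the
  bottom strand at \<open>b\<close>, and the middle strand passes over the bottom strand at \<open>c\<close>. The flags
  \<open>t\<close>, \<open>m\<close>, \<open>l\<close> tell whether the top strand meets \<open>a\<close> before \<open>b\<close>, the middle strand \<open>a\<close> before \<open>c\<close>,
  and the bottom strand \<open>b\<close> before \<open>c\<close>. The move negates all three flags.

  The configurations that bound a triangle in the plane are those satisfying \<open>triangle\<close>. Indeed,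
  let the strands be straight with directions \<open>u\<close>, \<open>v\<close>, \<open>w\<close> (top, middle, bottom), so that the signs
  are those of \<open>det(u,v)\<close>, \<open>det(u,w)\<close>, \<open>det(v,w)\<close>; put \<open>a\<close> at the origin and let the bottom strand
  be the line of all \<open>x\<close> with \<open>det(w,x) = s\<close>. Reading flags as signs \<open>+1\<close>, \<open>-1\<close>, one gets
  \<open>t = -sgn(s) eb\<close>, \<open>m = -sgn(s) ec\<close>, \<open>l = -sgn(s) ea eb ec\<close>. Eliminating \<open>sgn(s)\<close>, whose change is
  the move, leaves \<open>ea ec = t l\<close> and \<open>eb ec = t m\<close>, and all eight sign patterns occur.
\<close>

definition triangle :: "sign \<Rightarrow> sign \<Rightarrow> sign \<Rightarrow> bool \<Rightarrow> bool \<Rightarrow> bool \<Rightarrow> bool" where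
  "triangle ea eb ec t m l \<longleftrightarrow> ((ea = ec) = (t = l)) \<and> ((eb = ec) = (t = m))"

text \<open>
  Contexts before the first moved block are omitted where the step \<open>rotate\<close> supplies them. The two
  rules for RIII are the two possible cyclic orders of the three strands along the knot.
\<close>

inductive welded_step :: "code \<Rightarrow> code \<Rightarrow> bool" where
  rotate: "welded_step (xs @ ys) (ys @ xs)"
| relabel: "inj_on f (crossings w) \<Longrightarrow> welded_step w (map (relabel f) w)"
| RI_over_first: "welded_step ([Over a e, Under a e] @ xs) xs"
| RI_under_first: "welded_step ([Under a e, Over a e] @ xs) xs"
| RII_parallel:
    "welded_step ([Over a e, Over b (opp e)] @ xs @ [Under a e, Under b (opp e)] @ ys) (xs @ ys)"
| RII_antiparallel:
    "welded_step ([Over a e, Over b (opp e)] @ xs @ [Under b (opp e), Under a e] @ ys) (xs @ ys)"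
| RIII_top_middle_bottom:
    "triangle ea eb ec t m l \<Longrightarrow> welded_step
       (pair_in_order t (Over a ea) (Over b eb) @ xs @ pair_in_order m (Under a ea) (Over c ec) @ ys @
        pair_in_order l (Under b eb) (Under c ec) @ zs)
       (pair_in_order (\<not> t) (Over a ea) (Over b eb) @ xs @ pair_in_order (\<not> m) (Under a ea) (Over c ec) @ ys @
        pair_in_order (\<not> l) (Under b eb) (Under c ec) @ zs)"
| RIII_top_bottom_middle:
    "triangle ea eb ec t m l \<Longrightarrow> welded_step
       (pair_in_order t (Over a ea) (Over b eb) @ xs @ pair_in_order l (Under b eb) (Under c ec) @ ys @
        pair_in_order m (Under a ea) (Over c ec) @ zs)
       (pair_in_order (\<not> t) (Over a ea) (Over b eb) @ xs @ pair_in_order (\<not> l) (Under b eb) (Under c ec) @ ys @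
        pair_in_order (\<not> m) (Under a ea) (Over c ec) @ zs)"
| F1: "welded_step ([Over a e, Over b f] @ xs) ([Over b f, Over a e] @ xs)"

text \<open>
  Every code on the way has to be a Gauss code; in particular the labels of crossings created by
  an inverse RI or RII are fresh.
\<close>

definition welded_equiv :: "(code \<times> code) set" where
  "welded_equiv = {(v, w). gauss_code v \<and> gauss_code w \<and>
     equivclp (\<lambda>x y. gauss_code x \<and> gauss_code y \<and> welded_step x y) v w}"

lemma equiv_welded_equiv: "equiv {w. gauss_code w} welded_equiv"
  unfolding welded_equiv_def
  by (auto intro!: equivI refl_onI symI transI intro: equivclp_sym equivclp_trans)

text \<open>
  Knots are oriented: reversing the orientation is not one of the steps, so a knot need not
  contain the reverse of each of its diagrams.
\<close>

definition welded_knots :: "code set set" where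
  "welded_knots = {w. gauss_code w} // welded_equiv"

definition trivial_knot :: "code set" where
  "trivial_knot = welded_equiv `` {[]}"

text \<open>
  Every infimum of natural numbers below is taken over a nonempty set when \<open>K\<close> is a welded knot and
  the codes are Gauss codes, and is therefore a minimum.
\<close>

primrec twist_passage :: "nat \<Rightarrow> passage \<Rightarrow> passage" where
  "twist_passage c (Over d e) = (if d = c then Under d e else Over d e)"
| "twist_passage c (Under d e) = (if d = c then Over d e else Under d e)"

definition twist_move :: "code \<Rightarrow> code \<Rightarrow> bool" where
  "twist_move v w \<longleftrightarrow> (\<exists>c\<in>crossings v. w = map (twist_passage c) v)"

definition ut_diagram :: "code \<Rightarrow> nat" where
  "ut_diagram w = Inf {n. \<exists>v. (twist_move ^^ n) w v \<and> v \<in> trivial_knot}"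

definition unknotting_twist_number :: "code set \<Rightarrow> nat" where
  "unknotting_twist_number K = (INF w\<in>K. ut_diagram w)"

text \<open>A classical crossing changed to a welded one disappears from the Gauss code.\<close>

definition make_welded :: "nat set \<Rightarrow> code \<Rightarrow> code" where
  "make_welded C w = filter (\<lambda>x. label x \<notin> C) w"

definition uw_diagram :: "code \<Rightarrow> nat" where
  "uw_diagram w = Inf {card C | C. C \<subseteq> crossings w \<and> make_welded C w \<in> trivial_knot}"

definition welded_unknotting_number :: "code set \<Rightarrow> nat" where
  "welded_unknotting_number K = (INF w\<in>K. uw_diagram w)"

definition warping_crossings :: "code \<Rightarrow> nat set" where
  "warping_crossings w = {c. \<exists>e xs ys zs. w = xs @ [Under c e] @ ys @ [Over c e] @ zs}"

text \<open>The non-crossing base points, up to moving them along an edge, are the rotations of the code.\<close>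

definition warping_degree_diagram :: "code \<Rightarrow> nat" where
  "warping_degree_diagram w = (INF k. card (warping_crossings (List.rotate k w)))"

text \<open>
  Reversing the orientation reverses the word and keeps signs and over/under information.
\<close>

definition warping_degree :: "code set \<Rightarrow> nat" where
  "warping_degree K =
     Inf ({warping_degree_diagram w | w. w \<in> K} \<union> {warping_degree_diagram (rev w) | w. w \<in> K})"

end

theory Submission
  imports Defs "HOL-Library.Sublist" "HOL-Library.Multiset"
begin

text \<open>
  For the upper bound on the unknotting twist number, twisting every warping crossing of a based
  diagram reverses exactly the arrows that are met first at their head, so the result is
  descending. A descending diagram is trivial: before its first head there are only tails, among
  them the tail of the same arrow; by \<open>F1\<close> that tail slides up to the head, and RI removes the
  arrow (\<open>descending_trivial\<close>). For the reversed orientation the last head plays the role of the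
  first one (\<open>ascending_trivial\<close>).

  For the lower bound, one twist is simulated by welding two crossings. Next to the arrow \<open>c\<close> of
  sign \<open>e\<close>, RII creates two arrows \<open>a\<close> and \<open>b\<close> with signs \<open>e\<close> and \<open>opp e\<close>, both antiparallel to
  \<open>c\<close>; in a Gauss diagram this is possible wherever \<open>c\<close> is. After \<open>c\<close> and \<open>b\<close> are welded, what
  remains of the three is \<open>a\<close>, which is \<open>c\<close> reversed with its sign kept. Doing this once for each
  of \<open>n\<close> twists yields a diagram of the same knot in which welding at most \<open>2 * n\<close> crossings has
  the effect of the \<open>n\<close> twists, up to the names of the crossings (\<open>twists_by_welding\<close>).
\<close>

section \<open>Gauss codes and welded equivalence\<close>

lemma gauss_code_mset_cong:
  assumes "mset v = mset w" "gauss_code v"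
  shows "gauss_code w"
  using assms mset_eq_imp_distinct_iff[OF assms(1)] mset_eq_setD[OF assms(1)]
  unfolding gauss_code_def crossings_def by simp

lemma gauss_code_Nil: "gauss_code []"
  by (simp add: gauss_code_def crossings_def)

lemma gauss_code_filter_labels:
  assumes "gauss_code w"
  shows "gauss_code (filter (\<lambda>x. P (label x)) w)"
  unfolding gauss_code_def
proof (intro conjI ballI)
  show "distinct (filter (\<lambda>x. P (label x)) w)" using assms by (simp add: gauss_code_def)
next
  fix c assume "c \<in> crossings (filter (\<lambda>x. P (label x)) w)"
  then have c: "c \<in> crossings w" "P c" by (auto simp: crossings_def)
  then have "{x \<in> set (filter (\<lambda>x. P (label x)) w). label x = c} = {x \<in> set w. label x = c}"
    by auto
  then show "\<exists>e. {x \<in> set (filter (\<lambda>x. P (label x)) w). label x = c} = {Over c e, Under c e}"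
    using assms c by (simp add: gauss_code_def)
qed

lemma gauss_code_make_welded: "gauss_code w \<Longrightarrow> gauss_code (make_welded C w)"
  unfolding make_welded_def by (rule gauss_code_filter_labels)

lemma gauss_code_add_crossing:
  assumes "gauss_code w" "a \<notin> crossings w"
  shows "gauss_code (Over a e # Under a e # w)"
  unfolding gauss_code_def
proof (intro conjI ballI)
  show "distinct (Over a e # Under a e # w)"
    using assms by (auto simp: gauss_code_def crossings_def image_iff)
next
  fix c assume c: "c \<in> crossings (Over a e # Under a e # w)"
  show "\<exists>f. {x \<in> set (Over a e # Under a e # w). label x = c} = {Over c f, Under c f}"
  proof (cases "c = a")
    case True
    have "label x \<noteq> a" if "x \<in> set w" for x using assms(2) that by (auto simp: crossings_def)
    then have "{x \<in> set (Over a e # Under a e # w). label x = c} = {Over c e, Under c e}"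
      using True by auto
    then show ?thesis by blast
  next
    case False
    then have "{x \<in> set (Over a e # Under a e # w). label x = c} = {x \<in> set w. label x = c}"
      by auto
    moreover have "c \<in> crossings w" using c False by (auto simp: crossings_def)
    ultimately show ?thesis using assms(1) unfolding gauss_code_def by metis
  qed
qed

lemma gauss_code_sign_unique:
  assumes "gauss_code w" "x \<in> set w" "y \<in> set w" "label x = label y"
  shows "sgn_of x = sgn_of y"
proof -
  obtain e where "{z \<in> set w. label z = label x} = {Over (label x) e, Under (label x) e}"
    using assms(1,2) unfolding gauss_code_def crossings_def by (metis imageI)
  then have "x \<in> {Over (label x) e, Under (label x) e}" "y \<in> {Over (label x) e, Under (label x) e}"
    using assms by auto
  then show ?thesis by (metis insertE passage.sel(3,4) singletonD)
qed

lemma gauss_code_both_passages: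
  assumes "gauss_code w" "c \<in> crossings w"
  obtains e where "Over c e \<in> set w" "Under c e \<in> set w"
proof -
  obtain e where "{x \<in> set w. label x = c} = {Over c e, Under c e}"
    using assms unfolding gauss_code_def by metis
  then have "Over c e \<in> set w" "Under c e \<in> set w" by auto
  then show ?thesis by (rule that)
qed

lemma gauss_code_partner:
  assumes "gauss_code w" "Under c e \<in> set w"
  shows "Over c e \<in> set w"
proof -
  have "c \<in> crossings w" using imageI[OF assms(2), of label] by (simp add: crossings_def)
  with assms(1) obtain f where f: "Over c f \<in> set w" by (rule gauss_code_both_passages)
  with gauss_code_sign_unique[OF assms(1) assms(2) f] show ?thesis by simp
qed

lemma gauss_code_remove_crossing:
  assumes "gauss_code u" "mset u = mset (Over c e # Under c e # v)"
  shows "gauss_code v"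
proof -
  let ?w = "Over c e # Under c e # v"
  have g: "gauss_code ?w" using gauss_code_mset_cong[OF assms(2,1)] .
  have "label x \<noteq> c" if "x \<in> set v" for x
  proof
    assume "label x = c"
    moreover have "sgn_of x = e"
      using gauss_code_sign_unique[OF g, of x "Over c e"] that \<open>label x = c\<close> by simp
    ultimately have "x = Over c e \<or> x = Under c e" by (cases x) auto
    moreover have "distinct ?w" using g by (simp add: gauss_code_def)
    ultimately show False using that by auto
  qed
  then have "filter (\<lambda>x. label x \<noteq> c) ?w = v" by (simp add: filter_id_conv)
  then show ?thesis using gauss_code_filter_labels[OF g, of "\<lambda>l. l \<noteq> c"] by simp
qed

lemma welded_equiv_step:
  assumes "gauss_code v" "gauss_code w" "welded_step v w"
  shows "(v, w) \<in> welded_equiv"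
  using assms unfolding welded_equiv_def by (auto intro: r_into_equivclp)

lemma welded_equiv_sym: "(v, w) \<in> welded_equiv \<Longrightarrow> (w, v) \<in> welded_equiv"
  unfolding welded_equiv_def by (auto intro: equivclp_sym)

lemma welded_equiv_trans:
  "(u, v) \<in> welded_equiv \<Longrightarrow> (v, w) \<in> welded_equiv \<Longrightarrow> (u, w) \<in> welded_equiv"
  unfolding welded_equiv_def by (auto intro: equivclp_trans)

lemma welded_equiv_refl: "gauss_code w \<Longrightarrow> (w, w) \<in> welded_equiv"
  by (simp add: welded_equiv_def)

lemma welded_equiv_gauss_code:
  assumes "(v, w) \<in> welded_equiv"
  shows "gauss_code v" "gauss_code w"
  using assms by (auto simp: welded_equiv_def)

lemma welded_equiv_rotate:
  assumes "gauss_code (xs @ ys)"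
  shows "(xs @ ys, ys @ xs) \<in> welded_equiv"
  using assms gauss_code_mset_cong[of "xs @ ys" "ys @ xs"]
  by (intro welded_equiv_step welded_step.rotate) (auto simp: ac_simps)

text \<open>
  A move of a single block may be made anywhere in the code: rotate the block to the front, make
  the move, and rotate back.
\<close>

lemma welded_equiv_in_context:
  assumes step: "\<And>xs. welded_step (l @ xs) (r @ xs)"
    and gl: "gauss_code (p @ l @ q)" and gr: "gauss_code (p @ r @ q)"
  shows "(p @ l @ q, p @ r @ q) \<in> welded_equiv"
proof -
  have l: "(p @ l @ q, (l @ q) @ p) \<in> welded_equiv" by (rule welded_equiv_rotate[OF gl])
  have r: "(p @ r @ q, (r @ q) @ p) \<in> welded_equiv" by (rule welded_equiv_rotate[OF gr])
  have "((l @ q) @ p, (r @ q) @ p) \<in> welded_equiv"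
    using welded_equiv_step[OF welded_equiv_gauss_code(2)[OF l] welded_equiv_gauss_code(2)[OF r]]
      step[of "q @ p"] by simp
  then show ?thesis
    using l r by (meson welded_equiv_trans welded_equiv_sym)
qed

section \<open>Descending and ascending codes are trivial\<close>

lemma tail_slides_past_tails:
  assumes "gauss_code (p @ Over c e # os @ q)" "\<And>x. x \<in> set os \<Longrightarrow> \<exists>d f. x = Over d f"
  shows "(p @ Over c e # os @ q, p @ os @ Over c e # q) \<in> welded_equiv"
  using assms
proof (induction os arbitrary: p)
  case Nil
  then show ?case by (simp add: welded_equiv_refl)
next
  case (Cons x os)
  obtain d f where x: "x = Over d f" using Cons.prems(2)[of x] by auto
  have g: "gauss_code (p @ [x, Over c e] @ os @ q)"
    by (rule gauss_code_mset_cong[OF _ Cons.prems(1)]) simp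
  have g': "gauss_code (p @ [Over c e, x] @ os @ q)" using Cons.prems(1) by simp
  have swap: "(p @ [Over c e, x] @ os @ q, p @ [x, Over c e] @ os @ q) \<in> welded_equiv"
    using welded_equiv_in_context[OF _ g' g] unfolding x by (metis welded_step.F1)
  have "gauss_code ((p @ [x]) @ Over c e # os @ q)" using g by simp
  then have "((p @ [x]) @ Over c e # os @ q, (p @ [x]) @ os @ Over c e # q) \<in> welded_equiv"
    using Cons.prems(2) by (rule Cons.IH) simp
  then have "(p @ [x, Over c e] @ os @ q, p @ (x # os) @ Over c e # q) \<in> welded_equiv" by simp
  from welded_equiv_trans[OF swap this] show ?case by simp
qed

lemma remove_crossing_tail_first:
  assumes g: "gauss_code (p @ Over c e # os @ Under c e # q)"
    and os: "\<And>x. x \<in> set os \<Longrightarrow> \<exists>d f. x = Over d f"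
  shows "(p @ Over c e # os @ Under c e # q, p @ os @ q) \<in> welded_equiv"
proof -
  have slide: "(p @ Over c e # os @ Under c e # q, p @ os @ Over c e # Under c e # q) \<in> welded_equiv"
    using g os by (rule tail_slides_past_tails)
  have "gauss_code (p @ os @ q)"
    by (rule gauss_code_remove_crossing[OF g, where c = c and e = e]) simp
  then have "((p @ os) @ [Over c e, Under c e] @ q, (p @ os) @ [] @ q) \<in> welded_equiv"
    using welded_equiv_gauss_code(2)[OF slide]
    by (intro welded_equiv_in_context) (simp_all add: welded_step.RI_over_first[simplified])
  then have "(p @ os @ Over c e # Under c e # q, p @ os @ q) \<in> welded_equiv" by simp
  with slide show ?thesis by (rule welded_equiv_trans)
qed

lemma remove_crossing_head_first:
  assumes g: "gauss_code (p @ Under c e # os @ Over c e # q)"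
    and os: "\<And>x. x \<in> set os \<Longrightarrow> \<exists>d f. x = Over d f"
  shows "(p @ Under c e # os @ Over c e # q, p @ os @ q) \<in> welded_equiv"
proof -
  have g': "gauss_code ((p @ [Under c e]) @ Over c e # os @ q)"
    by (rule gauss_code_mset_cong[OF _ g]) simp
  have slide: "((p @ [Under c e]) @ Over c e # os @ q, (p @ [Under c e]) @ os @ Over c e # q) \<in> welded_equiv"
    using g' os by (rule tail_slides_past_tails)
  have "gauss_code (p @ os @ q)"
    by (rule gauss_code_remove_crossing[OF g, where c = c and e = e]) simp
  then have "(p @ [Under c e, Over c e] @ os @ q, p @ [] @ os @ q) \<in> welded_equiv"
    using g'
    by (intro welded_equiv_in_context) (simp_all add: welded_step.RI_under_first[simplified])
  then have remove: "(p @ Under c e # Over c e # os @ q, p @ os @ q) \<in> welded_equiv" by simp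
  have "(p @ Under c e # os @ Over c e # q, p @ Under c e # Over c e # os @ q) \<in> welded_equiv"
    using welded_equiv_sym[OF slide] by simp
  then show ?thesis using remove by (rule welded_equiv_trans)
qed

lemma trivial_knot_iff: "w \<in> trivial_knot \<longleftrightarrow> ([], w) \<in> welded_equiv"
  by (simp add: trivial_knot_def)

lemma trivial_knot_cong:
  "(v, w) \<in> welded_equiv \<Longrightarrow> w \<in> trivial_knot \<Longrightarrow> v \<in> trivial_knot"
  unfolding trivial_knot_iff by (meson welded_equiv_trans welded_equiv_sym)

lemma gauss_code_has_Under:
  assumes "gauss_code w" "w \<noteq> []"
  shows "\<exists>x\<in>set w. \<exists>c e. x = Under c e"
proof -
  from assms(2) have "label (hd w) \<in> crossings w" by (simp add: crossings_def)
  with assms(1) obtain e where "Under (label (hd w)) e \<in> set w" by (rule gauss_code_both_passages)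
  then show ?thesis by blast
qed

text \<open>
  The formulation by subsequences makes it evident that the property survives the deletion of a
  crossing, as the inductions below require.
\<close>

definition descending :: "code \<Rightarrow> bool" where
  "descending w \<longleftrightarrow> (\<forall>c e. \<not> subseq [Under c e, Over c e] w)"

lemma descending_subseq: "subseq v w \<Longrightarrow> descending w \<Longrightarrow> descending v"
  unfolding descending_def using subseq_order.order_trans by blast

lemma subseq_pair: "subseq [x, y] (p @ x # q @ y # r)"
proof -
  have "subseq ([] @ [x] @ [] @ [y] @ []) (p @ [x] @ q @ [y] @ r)"
    by (intro list_emb_append_mono) auto
  then show ?thesis by simp
qed

text \<open>
  Everything before the first head is a tail, and the tail of the same arrow is among them, so
  it can be slid to that head.
\<close>

lemma descending_trivial:
  assumes "gauss_code w" "descending w"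
  shows "w \<in> trivial_knot"
  using assms
proof (induction w rule: length_induct)
  case (1 w)
  show ?case
  proof (cases "w = []")
    case True
    then show ?thesis by (simp add: trivial_knot_iff welded_equiv_refl gauss_code_Nil)
  next
    case False
    from split_list_first_prop[OF gauss_code_has_Under[OF 1(2) this]]
    obtain os c e q where w: "w = os @ Under c e # q"
      and heads: "\<forall>x\<in>set os. \<not> (\<exists>d f. x = Under d f)"
      by (elim exE conjE) simp
    have os: "\<exists>d f. x = Over d f" if "x \<in> set os" for x using that heads by (metis passage.exhaust)
    have "Over c e \<in> set w" using gauss_code_partner[OF 1(2), of c e] w by simp
    moreover have "Over c e \<notin> set q"
    proof
      assume "Over c e \<in> set q"
      then obtain q1 q2 where "q = q1 @ Over c e # q2" by (meson split_list)
      then have "subseq [Under c e, Over c e] w"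
        using subseq_pair[of "Under c e" "Over c e" os q1 q2] w by simp
      then show False using 1(3) by (simp add: descending_def)
    qed
    ultimately have "Over c e \<in> set os" using w by simp
    then obtain p r where p: "os = p @ Over c e # r" by (meson split_list)
    have w2: "w = p @ Over c e # r @ Under c e # q" by (simp add: w p)
    have red: "(w, p @ r @ q) \<in> welded_equiv"
      unfolding w2 using 1(2)[unfolded w2] os p by (intro remove_crossing_tail_first) simp_all
    have "subseq (p @ r @ q) w"
      unfolding w2 by (intro list_emb_append_mono list_emb_Cons) simp_all
    then have "descending (p @ r @ q)" using 1(3) by (rule descending_subseq)
    then have "p @ r @ q \<in> trivial_knot"
      using 1(1) welded_equiv_gauss_code(2)[OF red] w2 by simp
    with red show ?thesis by (rule trivial_knot_cong)
  qed
qed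

text \<open>
  Everything after the last head is a tail, and the tail of the same arrow is among them. This
  mirror image of the previous argument is shorter than checking that every move survives the
  reversal of the orientation.
\<close>

lemma ascending_trivial:
  assumes "gauss_code w" "descending (rev w)"
  shows "w \<in> trivial_knot"
  using assms
proof (induction w rule: length_induct)
  case (1 w)
  show ?case
  proof (cases "w = []")
    case True
    then show ?thesis by (simp add: trivial_knot_iff welded_equiv_refl gauss_code_Nil)
  next
    case False
    from split_list_last_prop[OF gauss_code_has_Under[OF 1(2) this]]
    obtain p c e os where w: "w = p @ Under c e # os"
      and heads: "\<forall>x\<in>set os. \<not> (\<exists>d f. x = Under d f)"
      by (elim exE conjE) simp
    have os: "\<exists>d f. x = Over d f" if "x \<in> set os" for x using that heads by (metis passage.exhaust)
    have "Over c e \<in> set w" using gauss_code_partner[OF 1(2), of c e] w by simp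
    moreover have "Over c e \<notin> set p"
    proof
      assume "Over c e \<in> set p"
      then obtain p1 p2 where "p = p1 @ Over c e # p2" by (meson split_list)
      then have "subseq [Under c e, Over c e] (rev w)"
        using subseq_pair[of "Under c e" "Over c e" "rev os" "rev p2" "rev p1"] w by simp
      then show False using 1(3) by (simp add: descending_def)
    qed
    ultimately have "Over c e \<in> set os" using w by simp
    then obtain r q where r: "os = r @ Over c e # q" by (meson split_list)
    have w2: "w = p @ Under c e # r @ Over c e # q" by (simp add: w r)
    have red: "(w, p @ r @ q) \<in> welded_equiv"
      unfolding w2 using 1(2)[unfolded w2] os r by (intro remove_crossing_head_first) simp_all
    have "subseq ((rev q @ rev r) @ rev p) ((rev q @ Over c e # rev r) @ Under c e # rev p)"
      by (intro list_emb_append_mono list_emb_Cons) simp_all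
    then have "subseq (rev (p @ r @ q)) (rev w)" unfolding w2 by simp
    then have "descending (rev (p @ r @ q))" using 1(3) by (rule descending_subseq)
    then have "p @ r @ q \<in> trivial_knot"
      using 1(1) welded_equiv_gauss_code(2)[OF red] w2 by simp
    with red show ?thesis by (rule trivial_knot_cong)
  qed
qed

section \<open>Twisting the warping crossings\<close>

definition twist_all :: "nat set \<Rightarrow> passage \<Rightarrow> passage" where
  "twist_all C x = (if label x \<in> C then twist_passage (label x) x else x)"

lemma label_twist_all [simp]: "label (twist_all C x) = label x"
  by (cases x) (auto simp: twist_all_def)

lemma twist_all_involution [simp]: "twist_all C (twist_all C x) = x"
  by (cases x) (auto simp: twist_all_def)

lemma crossings_map_twist_all: "crossings (map (twist_all C) w) = crossings w"
  by (simp add: crossings_def image_image)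

lemma gauss_code_twist_all:
  assumes "gauss_code w"
  shows "gauss_code (map (twist_all C) w)"
  unfolding gauss_code_def crossings_map_twist_all
proof (intro conjI ballI)
  have "inj (twist_all C)" by (metis injI twist_all_involution)
  then show "distinct (map (twist_all C) w)"
    using assms by (simp add: gauss_code_def distinct_map inj_on_def)
next
  fix c assume "c \<in> crossings w"
  then obtain e where e: "{x \<in> set w. label x = c} = {Over c e, Under c e}"
    using assms by (auto simp: gauss_code_def)
  have "{x \<in> set (map (twist_all C) w). label x = c} = twist_all C ` {x \<in> set w. label x = c}"
    by auto
  also have "\<dots> = {Over c e, Under c e}" unfolding e by (auto simp: twist_all_def)
  finally show "\<exists>e. {x \<in> set (map (twist_all C) w). label x = c} = {Over c e, Under c e}" by blast
qed

lemma twist_moves_twist_all: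
  assumes "finite C" "C \<subseteq> crossings w"
  shows "(twist_move ^^ card C) w (map (twist_all C) w)"
  using assms
proof (induction C)
  case empty
  then show ?case by (simp add: twist_all_def)
next
  case (insert c C)
  have "twist_passage c (twist_all C x) = twist_all (insert c C) x" for x
    using insert.hyps by (cases x) (auto simp: twist_all_def)
  then have "map (twist_all (insert c C)) w = map (twist_passage c) (map (twist_all C) w)" by simp
  moreover have "c \<in> crossings (map (twist_all C) w)"
    using insert.prems by (simp add: crossings_map_twist_all)
  ultimately have "twist_move (map (twist_all C) w) (map (twist_all (insert c C)) w)"
    unfolding twist_move_def by blast
  then show ?case using insert by (auto intro: relcomppI)
qed

lemma warping_crossings_iff:
  "c \<in> warping_crossings w \<longleftrightarrow> (\<exists>e. subseq [Under c e, Over c e] w)"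
proof
  assume "c \<in> warping_crossings w"
  then obtain e xs ys zs where "w = xs @ [Under c e] @ ys @ [Over c e] @ zs"
    unfolding warping_crossings_def by blast
  then show "\<exists>e. subseq [Under c e, Over c e] w"
    using subseq_pair[of "Under c e" "Over c e" xs ys zs] by (intro exI[of _ e]) simp
next
  assume "\<exists>e. subseq [Under c e, Over c e] w"
  then obtain e where "subseq [Under c e, Over c e] w" ..
  then obtain xs v where "w = xs @ Under c e # v" "subseq [Over c e] v"
    by (auto dest!: list_emb_ConsD)
  moreover then obtain ys zs where "v = ys @ Over c e # zs"
    by (auto dest!: list_emb_ConsD)
  ultimately have "w = xs @ [Under c e] @ ys @ [Over c e] @ zs" by simp
  then show "c \<in> warping_crossings w" unfolding warping_crossings_def by blast
qed

lemma warping_crossings_subset: "warping_crossings w \<subseteq> crossings w"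
  by (force simp: warping_crossings_def crossings_def)

lemma distinct_subseq_antisym:
  "distinct w \<Longrightarrow> subseq [x, y] w \<Longrightarrow> subseq [y, x] w \<Longrightarrow> x = y"
  by (induction w) (auto simp: subseq_singleton_left split: if_splits dest: list_emb_set)

text \<open>
  A crossing that is under-first after the twists would have been either over-first and twisted,
  though only under-first crossings are twisted, or under-first and not twisted, though all such
  crossings are twisted.
\<close>

lemma descending_twist_warping_crossings:
  assumes "gauss_code w"
  shows "descending (map (twist_all (warping_crossings w)) w)"
  unfolding descending_def
proof (intro allI notI)
  fix c e
  let ?C = "warping_crossings w"
  assume "subseq [Under c e, Over c e] (map (twist_all ?C) w)"
  from subseq_map[OF this, of "twist_all ?C"]
  have *: "subseq [twist_all ?C (Under c e), twist_all ?C (Over c e)] w"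
    by (simp add: comp_def)
  show False
  proof (cases "c \<in> ?C")
    case False
    then show False using * warping_crossings_iff by (auto simp: twist_all_def)
  next
    case True
    then have o: "subseq [Over c e, Under c e] w" using * by (simp add: twist_all_def)
    from True obtain f where u: "subseq [Under c f, Over c f] w"
      using warping_crossings_iff by blast
    have "Over c e \<in> set w" "Over c f \<in> set w"
      using list_emb_set[OF o] list_emb_set[OF u] by auto
    then have "e = f" using gauss_code_sign_unique[OF assms] by fastforce
    then show False
      using distinct_subseq_antisym[of w] o u assms by (auto simp: gauss_code_def)
  qed
qed

lemma rotate_append_split:
  obtains xs ys where "w = xs @ ys" "rotate k w = ys @ xs"
  using rotate_drop_take append_take_drop_id by metis

lemma mset_rotate: "mset (rotate k w) = mset w"
  by (metis rotate_append_split mset_append union_commute)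

lemma twists_to_trivial:
  assumes "gauss_code w"
  shows "\<exists>v. (twist_move ^^ card (warping_crossings (rotate k w))) w v \<and> v \<in> trivial_knot"
proof -
  let ?C = "warping_crossings (rotate k w)"
  let ?v = "map (twist_all ?C) w"
  obtain xs ys where split: "?v = xs @ ys" "rotate k ?v = ys @ xs" by (rule rotate_append_split)
  have gv: "gauss_code ?v" using assms by (rule gauss_code_twist_all)
  have gr: "gauss_code (rotate k w)"
    by (rule gauss_code_mset_cong[OF _ assms]) (simp add: mset_rotate)
  have eq: "(?v, rotate k ?v) \<in> welded_equiv"
    using welded_equiv_rotate[of xs ys] gv split by simp
  have "descending (rotate k ?v)"
    using descending_twist_warping_crossings[OF gr] by (simp add: rotate_map)
  then have "?v \<in> trivial_knot"
    using trivial_knot_cong[OF eq] descending_trivial welded_equiv_gauss_code[OF eq] by blast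
  moreover have "?C \<subseteq> crossings w"
    using warping_crossings_subset[of "rotate k w"] by (simp add: crossings_def)
  ultimately show ?thesis
    using twist_moves_twist_all[of ?C w] finite_subset[of ?C "crossings w"]
    by (auto simp: crossings_def)
qed

text \<open>
  Twisting commutes with reversal, so the twists that make the reversed code descending make the
  code itself ascending, when both are read from the same base point on the knot.
\<close>

lemma twists_to_trivial_rev:
  assumes "gauss_code w"
  shows "\<exists>v. (twist_move ^^ card (warping_crossings (rotate k (rev w)))) w v \<and> v \<in> trivial_knot"
proof -
  let ?C = "warping_crossings (rotate k (rev w))"
  let ?v = "map (twist_all ?C) w"
  obtain xs ys where split: "rev ?v = xs @ ys" "rotate k (rev ?v) = ys @ xs"
    by (rule rotate_append_split)
  have gv: "gauss_code ?v" using assms by (rule gauss_code_twist_all)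
  have gr: "gauss_code (rotate k (rev w))"
    by (rule gauss_code_mset_cong[OF _ assms]) (simp add: mset_rotate)
  have v: "?v = rev ys @ rev xs" using split(1) by (metis rev_append rev_rev_ident)
  have eq: "(?v, rev (ys @ xs)) \<in> welded_equiv"
    using welded_equiv_rotate[of "rev ys" "rev xs"] gv unfolding v by simp
  have "descending (ys @ xs)"
    using descending_twist_warping_crossings[OF gr] split(2) by (simp add: rotate_map rev_map)
  then have "?v \<in> trivial_knot"
    using trivial_knot_cong[OF eq] ascending_trivial[of "rev (ys @ xs)"] welded_equiv_gauss_code[OF eq]
    by (metis rev_rev_ident)
  moreover have "?C \<subseteq> crossings w"
    using warping_crossings_subset[of "rotate k (rev w)"] by (simp add: crossings_def)
  ultimately show ?thesis
    using twist_moves_twist_all[of ?C w] finite_subset[of ?C "crossings w"]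
    by (auto simp: crossings_def)
qed

section \<open>Simulating a twist by welding two crossings\<close>

text \<open>
  The new passages stand right before those of \<open>c\<close>, with over and under exchanged, so that \<open>a\<close>
  takes the place of the twisted \<open>c\<close> once \<open>b\<close> and \<open>c\<close> are deleted. The crossing \<open>b\<close> has the
  opposite sign because RII creates crossings in such pairs only.
\<close>

primrec insert_reversed_pair :: "nat \<Rightarrow> nat \<Rightarrow> nat \<Rightarrow> passage \<Rightarrow> code" where
  "insert_reversed_pair c a b (Over d e) =
     (if d = c then [Under a e, Under b (opp e), Over d e] else [Over d e])"
| "insert_reversed_pair c a b (Under d e) =
     (if d = c then [Over a e, Over b (opp e), Under d e] else [Under d e])"

lemma insert_reversed_pair_other: "label x \<noteq> c \<Longrightarrow> insert_reversed_pair c a b x = [x]"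
  by (cases x) auto

lemma concat_insert_reversed_pair_other:
  "c \<notin> label ` set w \<Longrightarrow> concat (map (insert_reversed_pair c a b) w) = w"
  by (induction w) (auto simp: insert_reversed_pair_other)

lemma two_passages_split:
  assumes "distinct w" "x \<in> set w" "y \<in> set w" "x \<noteq> y"
  shows "(\<exists>p q r. w = p @ x # q @ y # r) \<or> (\<exists>p q r. w = p @ y # q @ x # r)"
proof -
  obtain p s where w: "w = p @ x # s" using assms(2) by (meson split_list)
  then have "y \<in> set p \<or> y \<in> set s" using assms(3,4) by auto
  then show ?thesis
  proof
    assume "y \<in> set p"
    then obtain p1 p2 where "p = p1 @ y # p2" by (meson split_list)
    with w have "w = p1 @ y # p2 @ x # s" by simp
    then show ?thesis by blast
  next
    assume "y \<in> set s"
    then show ?thesis using w by (metis split_list)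
  qed
qed

lemma insert_reversed_pair_equiv:
  assumes g: "gauss_code w" and c: "c \<in> crossings w"
    and a: "a \<notin> crossings w" and b: "b \<notin> crossings w" and ab: "a \<noteq> b"
  shows "(w, concat (map (insert_reversed_pair c a b) w)) \<in> welded_equiv"
proof -
  obtain e where e: "{x \<in> set w. label x = c} = {Over c e, Under c e}"
    using g c by (auto simp: gauss_code_def)
  then have mem: "Over c e \<in> set w" "Under c e \<in> set w" by auto
  have d: "distinct w" using g by (simp add: gauss_code_def)
  have other: "label x \<noteq> c" if "x \<in> set w" "x \<noteq> Over c e" "x \<noteq> Under c e" for x
    using e that by blast
  define w' where "w' = concat (map (insert_reversed_pair c a b) w)"
  \<comment> \<open>Once the base point is moved right before the over-passages of \<open>a\<close> and \<open>b\<close>, the parallel RII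
      move applies, whichever passage of \<open>c\<close> the original base point meets first.\<close>
  have *: "(w, w') \<in> welded_equiv"
    if w: "w = s @ t" and w': "w' = s' @ t'"
      and t: "t' @ s' = [Over a e, Over b (opp e)] @ xs @ [Under a e, Under b (opp e)] @ ys"
      "t @ s = xs @ ys" for s t s' t' xs ys
  proof -
    have "mset w' = mset (t' @ s')" using w' by simp
    also have "\<dots> = mset (Over a e # Under a e # Over b (opp e) # Under b (opp e) # t @ s)"
      unfolding t by simp
    finally have m: "mset w' = mset (Over a e # Under a e # Over b (opp e) # Under b (opp e) # w)"
      using w by simp
    have "gauss_code (Over a e # Under a e # Over b (opp e) # Under b (opp e) # w)"
      using a b ab by (intro gauss_code_add_crossing g) (auto simp: crossings_def)
    then have g': "gauss_code w'" using gauss_code_mset_cong[OF m[symmetric]] by blast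
    have r: "(w, t @ s) \<in> welded_equiv" using welded_equiv_rotate g w by blast
    have r': "(w', t' @ s') \<in> welded_equiv" using welded_equiv_rotate g' w' by blast
    have "(t' @ s', t @ s) \<in> welded_equiv"
      using welded_equiv_gauss_code(2)[OF r] welded_equiv_gauss_code(2)[OF r']
        welded_step.RII_parallel[of a e b xs ys] t
      by (intro welded_equiv_step) simp_all
    then show ?thesis using r r' by (meson welded_equiv_trans welded_equiv_sym)
  qed
  consider (over_first) p q r where "w = p @ Over c e # q @ Under c e # r"
    | (under_first) p q r where "w = p @ Under c e # q @ Over c e # r"
    using two_passages_split[OF d mem] by blast
  then have "(w, w') \<in> welded_equiv"
  proof cases
    case (over_first p q r)
    have "label x \<noteq> c" if "x \<in> set p \<union> set q \<union> set r" for x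
      using that d by (intro other) (auto simp: over_first)
    then have "c \<notin> label ` set p" "c \<notin> label ` set q" "c \<notin> label ` set r" by auto
    then have w': "w' = (p @ [Under a e, Under b (opp e)] @ Over c e # q) @
        ([Over a e, Over b (opp e)] @ Under c e # r)"
      unfolding w'_def over_first by (simp add: concat_insert_reversed_pair_other)
    show ?thesis
      by (rule *[of "p @ Over c e # q" "Under c e # r" _ _ "Under c e # r @ p" "Over c e # q", OF _ w'])
        (simp_all add: over_first)
  next
    case (under_first p q r)
    have "label x \<noteq> c" if "x \<in> set p \<union> set q \<union> set r" for x
      using that d by (intro other) (auto simp: under_first)
    then have "c \<notin> label ` set p" "c \<notin> label ` set q" "c \<notin> label ` set r" by auto
    then have w': "w' = p @ ([Over a e, Over b (opp e)] @ Under c e # q @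
        [Under a e, Under b (opp e)] @ Over c e # r)"
      unfolding w'_def under_first by (simp add: concat_insert_reversed_pair_other)
    show ?thesis
      by (rule *[of p "Under c e # q @ Over c e # r" _ _ "Under c e # q" "Over c e # r @ p", OF _ w'])
        (simp_all add: under_first)
  qed
  then show ?thesis by (simp add: w'_def)
qed

lemma make_welded_insert_reversed_pair:
  assumes "a \<notin> C" "a \<notin> crossings w" "b \<notin> crossings w" "a \<noteq> b" "c \<notin> C" "c \<in> crossings w"
  shows "make_welded (insert c (insert b C)) (concat (map (insert_reversed_pair c a b) w)) =
         map (relabel (id(c := a)) \<circ> twist_passage c) (make_welded C w)"
proof -
  have ac: "a \<noteq> c" using assms by auto
  have "make_welded (insert c (insert b C)) (insert_reversed_pair c a b x) =
      map (relabel (id(c := a)) \<circ> twist_passage c) (make_welded C [x])" if "label x \<noteq> b" for x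
    using that assms(1,4,5) ac by (cases x) (auto simp: make_welded_def)
  moreover have "label x \<noteq> b" if "x \<in> set w" for x using that assms(3) by (auto simp: crossings_def)
  ultimately have "\<forall>x\<in>set w. make_welded (insert c (insert b C)) (insert_reversed_pair c a b x) =
      map (relabel (id(c := a)) \<circ> twist_passage c) (make_welded C [x])" by blast
  then show ?thesis
    by (induction w) (auto simp: make_welded_def)
qed

text \<open>
  The welded code agrees with the twisted one only up to a relabelling \<open>f\<close>, because each twisted
  crossing is replaced by one with a new name. Carrying \<open>f\<close> along keeps the two codes equal letter
  by letter, so that the next twist finds its crossing in \<open>w'\<close> under the name \<open>f c\<close>.
\<close>

lemma twists_by_welding:
  assumes "(twist_move ^^ n) w v" "gauss_code w"
  shows "\<exists>w' C f. (w, w') \<in> welded_equiv \<and> C \<subseteq> crossings w' \<and> card C \<le> 2 * n \<and>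
           inj_on f (crossings v) \<and> make_welded C w' = map (relabel f) v"
  using assms
proof (induction n arbitrary: v)
  case 0
  have "relabel (\<lambda>l. l) x = x" for x by (cases x) auto
  then have "make_welded {} w = map (relabel (\<lambda>l. l)) w" by (simp add: make_welded_def map_idI)
  then show ?case using 0 welded_equiv_refl
    by (intro exI[of _ w] exI[of _ "{}"] exI[of _ "\<lambda>l. l"]) simp
next
  case (Suc n)
  then obtain u where u: "(twist_move ^^ n) w u" "twist_move u v" by auto
  then obtain w' C f where w': "(w, w') \<in> welded_equiv" and C: "C \<subseteq> crossings w'" "card C \<le> 2 * n"
    and f: "inj_on f (crossings u)" and eq: "make_welded C w' = map (relabel f) u"
    using Suc by blast
  from u(2) obtain c where c: "c \<in> crossings u" and v: "v = map (twist_passage c) u"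
    by (auto simp: twist_move_def)
  have label_relabel: "label (relabel f x) = f (label x)" for f x by (cases x) auto
  have label_twist: "label (twist_passage c x) = label x" for c x by (cases x) auto
  have cross: "f d \<in> crossings w' - C" if "d \<in> crossings u" for d
  proof -
    have "f ` crossings u = crossings (make_welded C w')"
      unfolding eq crossings_def by (simp add: image_image label_relabel)
    also have "\<dots> \<subseteq> crossings w' - C" by (auto simp: crossings_def make_welded_def)
    finally show ?thesis using that by blast
  qed
  have fin: "finite (crossings w')" by (simp add: crossings_def)
  obtain a where a: "a \<notin> crossings w'" using ex_new_if_finite[OF infinite_UNIV_nat fin] by blast
  obtain b where b: "b \<notin> insert a (crossings w')"
    using ex_new_if_finite[OF infinite_UNIV_nat, of "insert a (crossings w')"] fin by blast
  define w'' where "w'' = concat (map (insert_reversed_pair (f c) a b) w')"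
  have equiv: "(w, w'') \<in> welded_equiv"
    unfolding w''_def using welded_equiv_gauss_code(2)[OF w'] cross[OF c] a b
    by (intro welded_equiv_trans[OF w'] insert_reversed_pair_equiv) auto
  have sub: "insert (f c) (insert b C) \<subseteq> crossings w''"
  proof -
    have "set (insert_reversed_pair (f c) a b x) \<subseteq> set w''" if "x \<in> set w'" for x
      using that by (auto simp: w''_def)
    moreover have "x \<in> set (insert_reversed_pair (f c) a b x)" for x by (cases x) auto
    ultimately have "set w' \<subseteq> set w''" by blast
    then have "crossings w' \<subseteq> crossings w''" by (auto simp: crossings_def)
    moreover have "b \<in> crossings w''"
    proof -
      obtain x where x: "x \<in> set w'" "label x = f c" using cross[OF c] by (auto simp: crossings_def)
      have "b \<in> label ` set (insert_reversed_pair (label x) a b x)" by (cases x) simp_all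
      then have "b \<in> label ` set (insert_reversed_pair (f c) a b x)" using x(2) by simp
      then show ?thesis using x(1) by (force simp: w''_def crossings_def)
    qed
    ultimately show ?thesis using C cross[OF c] by auto
  qed
  have "card (insert (f c) (insert b C)) \<le> Suc (Suc (card C))"
    using finite_subset[OF C(1) fin] by (simp add: card_insert_if)
  then have card: "card (insert (f c) (insert b C)) \<le> 2 * Suc n" using C(2) by simp
  let ?f = "f(c := a)"
  have cv: "crossings v = crossings u" unfolding v crossings_def by (simp add: image_image label_twist)
  have inj: "inj_on ?f (crossings v)"
    unfolding cv using f cross a by (auto simp: inj_on_def)
  have "make_welded (insert (f c) (insert b C)) w'' =
      map (relabel (id(f c := a)) \<circ> twist_passage (f c)) (map (relabel f) u)"
    unfolding w''_def eq[symmetric] using a b C cross[OF c]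
    by (intro make_welded_insert_reversed_pair) auto
  also have "\<dots> = map (relabel ?f) v"
    unfolding v map_map
  proof (rule map_cong[OF refl])
    fix x assume "x \<in> set u"
    then have "f (label x) = f c \<longleftrightarrow> label x = c"
      using f c by (auto simp: inj_on_def crossings_def)
    then show "(relabel (id(f c := a)) \<circ> twist_passage (f c) \<circ> relabel f) x =
        (relabel ?f \<circ> twist_passage c) x"
      by (cases x) auto
  qed
  finally show ?case using equiv sub card inj by blast
qed

section \<open>The two inequalities\<close>

lemma Inf_nat_lower: "(n :: nat) \<in> A \<Longrightarrow> Inf A \<le> n"
  by (rule cInf_lower) auto

lemma ut_diagram_le_rotation:
  assumes "gauss_code w"
  shows "ut_diagram w \<le> card (warping_crossings (rotate k w))"
    "ut_diagram w \<le> card (warping_crossings (rotate k (rev w)))"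
  unfolding ut_diagram_def using twists_to_trivial[OF assms] twists_to_trivial_rev[OF assms]
  by (auto intro!: Inf_nat_lower)

lemma ut_diagram_le_warping_degree_diagram:
  assumes "gauss_code w"
  shows "ut_diagram w \<le> warping_degree_diagram w" "ut_diagram w \<le> warping_degree_diagram (rev w)"
  unfolding warping_degree_diagram_def
  by (auto intro!: cINF_greatest ut_diagram_le_rotation[OF assms])

lemma ut_diagram_attained:
  assumes "gauss_code w"
  obtains v where "(twist_move ^^ ut_diagram w) w v" "v \<in> trivial_knot"
proof -
  have "{n. \<exists>v. (twist_move ^^ n) w v \<and> v \<in> trivial_knot} \<noteq> {}"
    using twists_to_trivial[OF assms] by blast
  from Inf_nat_def1[OF this] show ?thesis using that unfolding ut_diagram_def by blast
qed

text \<open>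
  The two numbers are compared on different diagrams of the same knot. This suffices because the
  welded unknotting number is a minimum over all diagrams.
\<close>

lemma uw_diagram_le_twice_ut_diagram:
  assumes "gauss_code w"
  shows "\<exists>w'. (w, w') \<in> welded_equiv \<and> uw_diagram w' \<le> 2 * ut_diagram w"
proof -
  obtain v where v: "(twist_move ^^ ut_diagram w) w v" "v \<in> trivial_knot"
    using ut_diagram_attained[OF assms] .
  obtain w' C f where w': "(w, w') \<in> welded_equiv" and C: "C \<subseteq> crossings w'"
    "card C \<le> 2 * ut_diagram w" and f: "inj_on f (crossings v)"
    and eq: "make_welded C w' = map (relabel f) v"
    using twists_by_welding[OF v(1) assms] by blast
  have gv: "gauss_code v" using v(2) welded_equiv_gauss_code(2) by (auto simp: trivial_knot_iff)
  have "gauss_code (make_welded C w')"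
    using gauss_code_make_welded welded_equiv_gauss_code(2)[OF w'] by blast
  then have "(v, make_welded C w') \<in> welded_equiv"
    using gv f unfolding eq by (intro welded_equiv_step welded_step.relabel)
  then have "make_welded C w' \<in> trivial_knot"
    using trivial_knot_cong welded_equiv_sym v(2) by blast
  then have "uw_diagram w' \<le> card C"
    unfolding uw_diagram_def using C(1) by (intro Inf_nat_lower) blast
  with w' C(2) show ?thesis by (meson le_trans)
qed

theorem theorem3p2:
  fixes K :: "code set"
  assumes "K \<in> welded_knots"
  shows "1 / 2 * real (welded_unknotting_number K) \<le> real (unknotting_twist_number K) \<and>
         unknotting_twist_number K \<le> warping_degree K"
proof -
  obtain k where k: "gauss_code k" "K = welded_equiv `` {k}"
    using assms by (auto simp: welded_knots_def quotient_def)
  have ne: "k \<in> K" using k welded_equiv_refl by simp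
  have gK: "gauss_code w" if "w \<in> K" for w using that k welded_equiv_gauss_code(2) by auto
  have "unknotting_twist_number K \<in> ut_diagram ` K"
    unfolding unknotting_twist_number_def using ne by (intro Inf_nat_def1) blast
  then obtain w where w: "w \<in> K" "unknotting_twist_number K = ut_diagram w" by blast
  obtain w' where w': "(w, w') \<in> welded_equiv" "uw_diagram w' \<le> 2 * ut_diagram w"
    using uw_diagram_le_twice_ut_diagram[OF gK[OF w(1)]] by blast
  have "w' \<in> K" using w(1) w'(1) k(2) welded_equiv_trans by blast
  then have "welded_unknotting_number K \<le> uw_diagram w'"
    unfolding welded_unknotting_number_def by (intro Inf_nat_lower) blast
  with w' w(2) have "welded_unknotting_number K \<le> 2 * unknotting_twist_number K" by simp
  then have "1 / 2 * real (welded_unknotting_number K) \<le> real (unknotting_twist_number K)" by simp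
  moreover have "unknotting_twist_number K \<le> warping_degree K"
    unfolding warping_degree_def
  proof (rule cInf_greatest)
    show "{warping_degree_diagram w |w. w \<in> K} \<union> {warping_degree_diagram (rev w) |w. w \<in> K} \<noteq> {}"
      using ne by blast
  next
    fix n assume "n \<in> {warping_degree_diagram w |w. w \<in> K} \<union> {warping_degree_diagram (rev w) |w. w \<in> K}"
    then obtain v where v: "v \<in> K" "n = warping_degree_diagram v \<or> n = warping_degree_diagram (rev v)"
      by blast
    have "unknotting_twist_number K \<le> ut_diagram v"
      unfolding unknotting_twist_number_def using v(1) by (intro Inf_nat_lower) blast
    also have "\<dots> \<le> n" using v(2) ut_diagram_le_warping_degree_diagram[OF gK[OF v(1)]] by auto
    finally show "unknotting_twist_number K \<le> n" .
  qed
  ultimately show ?thesis ..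
qed

end
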